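(* Let $u$ be a word. Then $u$ is perfect if and only if $u$ contains no non-trivial palindrome as a factor.
   Context: Words are over a fixed alphabet. For integers $i,k$, $[i,k]=\{j\in\mathbb{Z} : i\le j\le k\}$. For a word $u=a_1\cdots a_n$ and $f\colon[1,m]\to[1,n]$, $u^f=a_{f(1)}\cdots a_{f(m)}$. A walk is a surjection $f\colon[1,m]\to[1,n]$ with $|f(i+1)-f(i)|\le 1$ for $1\le i<m$; a walk on $u$ is a walk with co-domain $[1,|u|]$. A word $u$ generates $w$ if $w=u^f$ for some walk $f$. A word is primitive if it is not generated by any strictly shorter word. A word $u$ is perfect if it is primitive and, for any walks $f,g$ on $u$ with the same domain, $u^f=u^g$ implies $f=g$. A palindrome is a word equal to its reversal; it is non-trivial if it has length at least $2$. *)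

theory Defs
  imports Main "HOL-Library.Sublist" "HOL-Library.FuncSet"
begin

text \<open>Words are lists. Positions are numbered from 1, so the letter at position \<open>i\<close> of \<open>u\<close>
  is \<open>u ! (i - 1)\<close>. A function with domain \<open>{1..m}\<close> is represented extensionally, so that two
  functions on the same domain are equal iff they are equal as HOL functions.\<close>

definition walk :: "nat \<Rightarrow> nat \<Rightarrow> (nat \<Rightarrow> nat) \<Rightarrow> bool" where
  "walk m n f \<longleftrightarrow>
     f \<in> {1..m} \<rightarrow>\<^sub>E {1..n} \<and> f ` {1..m} = {1..n} \<and>
     (\<forall>i. 1 \<le> i \<and> i < m \<longrightarrow> \<bar>int (f (i + 1)) - int (f i)\<bar> \<le> 1)"

definition word_along :: "'a list \<Rightarrow> nat \<Rightarrow> (nat \<Rightarrow> nat) \<Rightarrow> 'a list" where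
  "word_along u m f = map (\<lambda>i. u ! (f i - 1)) [1..<m + 1]"

definition generates :: "'a list \<Rightarrow> 'a list \<Rightarrow> bool" where
  "generates u w \<longleftrightarrow> (\<exists>m f. walk m (length u) f \<and> w = word_along u m f)"

definition primitive :: "'a list \<Rightarrow> bool" where
  "primitive u \<longleftrightarrow> \<not> (\<exists>v. length v < length u \<and> generates v u)"

definition perfect :: "'a list \<Rightarrow> bool" where
  "perfect u \<longleftrightarrow> primitive u \<and>
     (\<forall>m f g. walk m (length u) f \<and> walk m (length u) g \<and>
        word_along u m f = word_along u m g \<longrightarrow> f = g)"

definition palindrome :: "'a list \<Rightarrow> bool" where
  "palindrome p \<longleftrightarrow> rev p = p"

definition nontrivial_palindrome :: "'a list \<Rightarrow> bool" where
  "nontrivial_palindrome p \<longleftrightarrow> palindrome p \<and> length p \<ge> 2"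

end

theory Submission
  imports Defs
begin

text \<open>The centre of a non-trivial palindrome is a factor \<open>aa\<close> or \<open>aba\<close>, so \<open>u\<close> has no such factor
  iff any two distinct positions at distance at most 2 carry different letters. If they do,
  then two walks yielding the same word, once they meet, agree for ever (forwards and backwards);
  if they never meet they cannot cross either, so one stays strictly below the other and never
  reaches the last letter. Moreover a walk producing \<open>u\<close> can neither pause nor turn, hence is
  injective, and \<open>u\<close> is primitive. Conversely, at a factor \<open>aa\<close> or \<open>aba\<close> a walk can make a detour
  in two different ways without changing the word.\<close>

definition short_repeat :: "'a list \<Rightarrow> bool" where
  "short_repeat u \<longleftrightarrow> (\<exists>i d. d \<in> {1, 2} \<and> i + d < length u \<and> u ! i = u ! (i + d))"

lemma palindrome_factor_iff_short_repeat:
  "(\<exists>p. sublist p u \<and> nontrivial_palindrome p) \<longleftrightarrow> short_repeat u"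
proof
  assume "\<exists>p. sublist p u \<and> nontrivial_palindrome p"
  then obtain xs p ys where u: "u = xs @ p @ ys" and p: "rev p = p" and L: "length p \<ge> 2"
    by (auto simp: sublist_def nontrivial_palindrome_def palindrome_def)
  \<comment> \<open>The two positions nearest the centre that reversal exchanges are
    \<open>j\<close> and \<open>j + d\<close>, counted from 0:
    \<open>length p = 2 * j + d + 1\<close>.\<close>
  define d :: nat where "d = (if even (length p) then 1 else 2)"
  define j where "j = (length p - d) div 2"
  have d: "d \<in> {1, 2}" by (simp add: d_def)
  have jd: "j + d < length p" "length p - Suc j = j + d"
    using L by (cases "even (length p)"; auto simp: j_def d_def elim!: evenE oddE; presburger)+
  have "p ! j = rev p ! j" using p by simp
  also have "\<dots> = p ! (j + d)" using jd by (simp add: rev_nth)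
  finally have "u ! (length xs + j) = u ! (length xs + j + d)"
    using jd by (simp add: u nth_append)
  moreover have "length xs + j + d < length u" using jd by (simp add: u)
  ultimately show "short_repeat u" using d unfolding short_repeat_def by blast
next
  assume "short_repeat u"
  then obtain i d where d: "d \<in> {1, 2}" and i: "i + d < length u" and eq: "u ! i = u ! (i + d)"
    unfolding short_repeat_def by blast
  define p where "p = take (Suc d) (drop i u)"
  have len: "length p = Suc d" using i by (simp add: p_def)
  have "u = take i u @ p @ drop (Suc d) (drop i u)" unfolding p_def by (metis append_take_drop_id)
  then have "sublist p u" unfolding sublist_def by blast
  moreover have "rev p = p"
  proof (rule nth_equalityI)
    fix k assume "k < length (rev p)"
    then have k: "k \<le> d" using len by simp
    \<comment> \<open>An end of \<open>p\<close> or, for \<open>d = 2\<close>, its middle, which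
      reversal fixes.\<close>
    have "k = 0 \<or> k = d \<or> d = k + k" using k d by auto
    then show "rev p ! k = p ! k" using k len i eq by (auto simp: rev_nth p_def)
  qed simp
  ultimately show "\<exists>p. sublist p u \<and> nontrivial_palindrome p"
    using len d by (auto simp: nontrivial_palindrome_def palindrome_def intro!: exI[of _ p])
qed

lemma walk_range:
  assumes "walk m n f" "1 \<le> i" "i \<le> m"
  shows "1 \<le> f i" "f i \<le> n"
  using assms by (auto simp: walk_def PiE_def Pi_def)

lemma walk_step:
  assumes "walk m n f" "1 \<le> i" "i < m"
  shows "\<bar>int (f (Suc i)) - int (f i)\<bar> \<le> 1"
  using assms by (auto simp: walk_def)

lemma word_along_eqD:
  assumes "word_along u m f = word_along v m g" "1 \<le> i" "i \<le> m"
  shows "u ! (f i - 1) = v ! (g i - 1)"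
  using assms by (auto simp: word_along_def)

lemma short_repeatI:
  assumes "1 \<le> i" "i < j" "j \<le> i + 2" "j \<le> length u" "u ! (i - 1) = u ! (j - 1)"
  shows "short_repeat u"
  unfolding short_repeat_def using assms
  by (intro exI[of _ "i - 1"] exI[of _ "j - i"]) auto

lemma nearby_positions_eq:
  assumes "\<not> short_repeat u" "1 \<le> i" "i \<le> length u" "1 \<le> j" "j \<le> length u"
    and "\<bar>int i - int j\<bar> \<le> 2" "u ! (i - 1) = u ! (j - 1)"
  shows "i = j"
proof (rule ccontr)
  assume "i \<noteq> j"
  then consider "i < j" | "j < i" by linarith
  then show False
    by cases (use assms short_repeatI[of i j u] short_repeatI[of j i u] in auto)
qed

text \<open>One step changes the difference of two walks by at most 2. If they agree at one of the
  two times, they are thus at distance at most 2 at the other, where equal letters force equal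
  positions.\<close>

lemma walks_eq_propagate:
  assumes nr: "\<not> short_repeat u" and f: "walk m (length u) f" and g: "walk m (length u) g"
    and eq: "word_along u m f = word_along u m g" and i: "1 \<le> i" "i < m"
  shows "f i = g i \<longleftrightarrow> f (Suc i) = g (Suc i)"
proof -
  have near: "f j = g j" if "j \<in> {i, Suc i}" "\<bar>int (f j) - int (g j)\<bar> \<le> 2" for j
    using that i nearby_positions_eq[OF nr, of "f j" "g j"] walk_range[OF f, of j]
      walk_range[OF g, of j] word_along_eqD[OF eq, of j] by auto
  show ?thesis
    using near[of i] near[of "Suc i"] walk_step[OF f i] walk_step[OF g i] by auto
qed

lemma walks_eq_everywhere:
  assumes nr: "\<not> short_repeat u" and f: "walk m (length u) f" and g: "walk m (length u) g"
    and eq: "word_along u m f = word_along u m g"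
    and k: "1 \<le> k" "k \<le> m" "f k = g k" and j: "1 \<le> j" "j \<le> m"
  shows "f j = g j"
proof -
  have all: "f i = g i \<longleftrightarrow> f 1 = g 1" if "1 \<le> i" "i \<le> m" for i
    using that
  proof (induction i rule: dec_induct)
    case (step i)
    then show ?case using walks_eq_propagate[OF nr f g eq, of i] by auto
  qed simp
  show ?thesis using all[of k] all[of j] k j by simp
qed

lemma walks_not_separated:
  assumes nr: "\<not> short_repeat u" and f: "walk m (length u) f" and g: "walk m (length u) g"
    and eq: "word_along u m f = word_along u m g"
    and ne: "\<And>i. 1 \<le> i \<Longrightarrow> i \<le> m \<Longrightarrow> f i \<noteq> g i" and m: "1 \<le> m" and lt: "f 1 < g 1"
  shows False
proof -
  have below: "f i < g i" if "1 \<le> i" "i \<le> m" for i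
    using that
  proof (induction i rule: dec_induct)
    case base
    show ?case by (rule lt)
  next
    case (step i)
    \<comment> \<open>Distinct positions with equal letters are at least 3 apart, and one step
      closes this gap by at most 2, so the order persists.\<close>
    have far: "\<not> \<bar>int (f i) - int (g i)\<bar> \<le> 2"
      using step nearby_positions_eq[OF nr, of "f i" "g i"] walk_range[OF f, of i]
        walk_range[OF g, of i] word_along_eqD[OF eq, of i] ne[of i] by auto
    show ?case using far step walk_step[OF f, of i] walk_step[OF g, of i] by auto
  qed
  \<comment> \<open>As \<open>m \<ge> 1\<close>, the word is nonempty and surjectivity yields a time
    at which \<open>f\<close> is at the last letter, leaving no room for \<open>g\<close> above
    it.\<close>
  have "length u \<in> f ` {1..m}"
    using f walk_range[OF f, of 1] m by (auto simp: walk_def)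
  then obtain i where i: "1 \<le> i" "i \<le> m" "f i = length u" by auto
  then show False using below[of i] walk_range[OF g, of i] by simp
qed

lemma walk_unique:
  assumes nr: "\<not> short_repeat u" and f: "walk m (length u) f" and g: "walk m (length u) g"
    and eq: "word_along u m f = word_along u m g"
  shows "f = g"
proof -
  have "f i = g i" if i: "i \<in> {1..m}" for i
  proof (rule ccontr)
    assume ni: "f i \<noteq> g i"
    have ne: "f j \<noteq> g j" if "1 \<le> j" "j \<le> m" for j
      using walks_eq_everywhere[OF nr f g eq that] ni i by auto
    have m: "1 \<le> m" using i by simp
    show False
    proof (cases "f 1 < g 1")
      case True
      then show ?thesis using walks_not_separated[OF nr f g eq ne m] by blast
    next
      case False
      then have "g 1 < f 1" using ne[of 1] m by simp
      then show ?thesis using walks_not_separated[OF nr g f eq[symmetric] _ m] ne by metis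
    qed
  qed
  then show ?thesis
    using f g by (intro PiE_ext[of f "{1..m}" "\<lambda>_. {1..length u}" g]) (auto simp: walk_def)
qed

text \<open>Without pauses every step is 1 or -1, and a change of sign would return to
  \<open>f i\<close> after two steps. So \<open>f\<close> is affine with nonzero slope
  \<open>s\<close>.\<close>

lemma straight_walk_inj_on:
  assumes f: "walk m n f"
    and pause: "\<And>i. 1 \<le> i \<Longrightarrow> i < m \<Longrightarrow> f i \<noteq> f (Suc i)"
    and turn: "\<And>i. 1 \<le> i \<Longrightarrow> Suc i < m \<Longrightarrow> f i \<noteq> f (i + 2)"
  shows "inj_on f {1..m}"
proof -
  \<comment> \<open>For \<open>m = 1\<close> the value \<open>f 2\<close> is arbitrary, but then
    \<open>s\<close> is only ever multiplied by 0.\<close>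
  define s where "s = int (f 2) - int (f 1)"
  have lin: "(i < m \<longrightarrow> int (f (Suc i)) - int (f i) = s) \<and> int (f i) = int (f 1) + s * (int i - 1)"
    if "1 \<le> i" "i \<le> m" for i
    using that
  proof (induction i rule: dec_induct)
    case base
    then show ?case by (simp add: s_def numeral_2_eq_2)
  next
    case (step i)
    then have st: "int (f (Suc i)) - int (f i) = s"
      and fi: "int (f i) = int (f 1) + s * (int i - 1)" by auto
    have "int (f (Suc i)) = int (f 1) + s * (int (Suc i) - 1)"
      using st fi by (simp add: algebra_simps)
    moreover have "int (f (Suc (Suc i))) - int (f (Suc i)) = s" if "Suc i < m"
      using st walk_step[OF f, of i] walk_step[OF f, of "Suc i"] pause[of i] pause[of "Suc i"]
        turn[of i] that step by auto
    ultimately show ?case by blast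
  qed
  show ?thesis
  proof (cases "m \<le> 1")
    case True
    then show ?thesis by (auto simp: inj_on_def)
  next
    case False
    then have "s \<noteq> 0" using pause[of 1] by (simp add: s_def numeral_2_eq_2)
    show ?thesis
    proof (rule inj_onI)
      fix i j assume "i \<in> {1..m}" "j \<in> {1..m}" "f i = f j"
      then have "s * (int i - 1) = s * (int j - 1)" using lin[of i] lin[of j] by auto
      then show "i = j" using \<open>s \<noteq> 0\<close> by simp
    qed
  qed
qed

text \<open>A pause or a turn of the generating walk would put \<open>aa\<close> or
  \<open>aba\<close> into \<open>u\<close>. An injective walk maps onto as many positions as it has
  times, so \<open>v\<close> cannot be shorter.\<close>

lemma primitive_if_no_short_repeat:
  assumes nr: "\<not> short_repeat u"
  shows "primitive u"
  unfolding primitive_def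
proof
  assume "\<exists>v. length v < length u \<and> generates v u"
  then obtain v m f where lt: "length v < length u" and f: "walk m (length v) f"
    and u: "u = word_along v m f" by (auto simp: generates_def)
  have len: "length u = m" unfolding u by (simp add: word_along_def)
  have nth: "u ! (i - 1) = v ! (f i - 1)" if "1 \<le> i" "i \<le> m" for i
    using that unfolding u by (cases i) (auto simp: word_along_def simp del: upt_Suc)
  have "inj_on f {1..m}"
  proof (rule straight_walk_inj_on[OF f])
    show "f i \<noteq> f (Suc i)" if "1 \<le> i" "i < m" for i
      using that nr short_repeatI[of i "Suc i" u] nth[of i] nth[of "Suc i"] len by auto
    show "f i \<noteq> f (i + 2)" if "1 \<le> i" "Suc i < m" for i
      using that nr short_repeatI[of i "i + 2" u] nth[of i] nth[of "i + 2"] len by auto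
  qed
  then have "card (f ` {1..m}) = m" by (simp add: card_image)
  moreover have "f ` {1..m} = {1..length v}" using f by (simp add: walk_def)
  ultimately show False using lt len by simp
qed

text \<open>For \<open>d = 1\<close> the walk pauses at \<open>i\<close> or at \<open>i + 1\<close>; for \<open>d = 2\<close> it interrupts its way at
  \<open>i + 1\<close> for an excursion to \<open>i\<close> or to \<open>i + 2\<close>.\<close>

definition detour :: "nat \<Rightarrow> nat \<Rightarrow> nat \<Rightarrow> nat \<Rightarrow> nat \<Rightarrow> nat" where
  "detour n d i x = (\<lambda>j \<in> {1..n + d}. if j < i + d then j else if j = i + d then x else j - d)"

text \<open>The values just before and after \<open>x\<close> are \<open>i + d - 1\<close> and
  \<open>i + 1\<close>. Since \<open>d \<le> 2\<close>, both are within 1 of \<open>i\<close> and of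
  \<open>i + d\<close>.\<close>

lemma walk_detour:
  assumes d: "d \<in> {1, 2}" and i: "1 \<le> i" "i + d \<le> n" and x: "x \<in> {i, i + d}"
  shows "walk (n + d) n (detour n d i x)"
  unfolding walk_def
proof (intro conjI)
  let ?f = "detour n d i x"
  show maps: "?f \<in> {1..n + d} \<rightarrow>\<^sub>E {1..n}"
    using assms by (auto simp: detour_def)
  show "?f ` {1..n + d} = {1..n}"
  proof
    show "?f ` {1..n + d} \<subseteq> {1..n}" using maps by (auto simp: PiE_def Pi_def)
    show "{1..n} \<subseteq> ?f ` {1..n + d}"
    proof
      fix y assume y: "y \<in> {1..n}"
      \<comment> \<open>Positions below \<open>i + d\<close> are visited before the detour, the
        others after it with delay \<open>d\<close>.\<close>
      then have "y = ?f (if y < i + d then y else y + d)"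
        using d i by (auto simp: detour_def)
      then show "y \<in> ?f ` {1..n + d}" by (rule image_eqI) (use y in auto)
    qed
  qed
  show "\<forall>j. 1 \<le> j \<and> j < n + d \<longrightarrow> \<bar>int (?f (j + 1)) - int (?f j)\<bar> \<le> 1"
    using assms by (auto simp: detour_def)
qed

lemma not_perfect_if_short_repeat:
  assumes "short_repeat u"
  shows "\<not> perfect u"
proof -
  obtain i d where d: "d \<in> {1, 2}" and i: "i + d < length u" and eq: "u ! i = u ! (i + d)"
    using assms unfolding short_repeat_def by blast
  \<comment> \<open>List index \<open>i\<close> is position \<open>Suc i\<close> for a walk. The two
    detours differ only at time \<open>Suc i + d\<close>, where they read the equal letters
    \<open>u ! i\<close> and \<open>u ! (i + d)\<close>.\<close>
  let ?f = "detour (length u) d (Suc i)"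
  have "walk (length u + d) (length u) (?f (Suc i))"
    "walk (length u + d) (length u) (?f (Suc i + d))"
    by (rule walk_detour; use d i in simp)+
  moreover have "word_along u (length u + d) (?f (Suc i))
      = word_along u (length u + d) (?f (Suc i + d))"
    using eq i by (auto simp: word_along_def detour_def)
  moreover have "?f (Suc i) (Suc i + d) \<noteq> ?f (Suc i + d) (Suc i + d)"
    using d i by (auto simp: detour_def)
  ultimately show ?thesis unfolding perfect_def by metis
qed

theorem theorem2:
  fixes u :: "'a list"
  shows "perfect u \<longleftrightarrow> \<not> (\<exists>p. sublist p u \<and> nontrivial_palindrome p)"
  unfolding palindrome_factor_iff_short_repeat
  using not_perfect_if_short_repeat primitive_if_no_short_repeat walk_unique
  unfolding perfect_def by metis

end
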